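(* Let $M$ be a positive integer and let $\nu=(\nu_1,\dots,\nu_l)$ be a partition with $\nu_1\le M$. Then $$\mathbf{B}(x)|\nu)=\sum_{\nu\prec \mu\subseteq [l+1,M]}x^{|\mu|-|\nu|}\,|\mu),$$ where the sum is over partitions $\mu=(\mu_1,\dots,\mu_{l+1})$ (weakly decreasing non-negative integers) with $\mu_1\le M$ and $\mu\succ\nu$.
   Context: $b(i),c(i)$ ($i\in\mathbb Z$) satisfy $\{b(i),c(j)\}=\delta_{i,-j}$, $\{b(i),b(j)\}=\{c(i),c(j)\}=0$, where $\{A,B\}=AB+BA$. The Fock space is generated by $|0\rangle$ with $b(m+1)|0\rangle=c(m)|0\rangle=0$ for $m\ge 0$. For a fixed positive integer $M$, $$\mathbf B(x)=\exp(x\,b(-M+1)c(M-2))\exp(x\,b(-M+2)c(M-3))\cdots,$$ the ordered product of $\exp(x\,b(-(i-1))c(i-2))$, $i\le M$, with $i$ decreasing from left to right; on each fixed Fock-space vector all but finitely many factors act as the identity. For a partition $\mu=(\mu_1,\dots,\mu_l)$ put $m_i=\mu_i-i$ and $$|\mu)=b(-m_1)b(-m_2)\cdots b(-m_l)\,c(-l)c(-l+1)\cdots c(-1)|0\rangle$$ (this is unchanged if zero parts are appended to $\mu$). $|\mu|=\sum_i\mu_i$. A partition $\mu=(\mu_1,\dots,\mu_{l+1})$ interlaces $\nu=(\nu_1,\dots,\nu_l)$, written $\mu\succ\nu$ or $\nu\prec\mu$, if $\mu_i\ge\nu_i\ge\mu_{i+1}$ for all $1\le i\le l$. *)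

theory Defs
  imports Complex_Main "HOL-Library.Groups_Big_Fun" "HOL-Library.Poly_Mapping" "HOL-Library.FSet"
begin

section \<open>The fermionic Fock space\<close>

text \<open>
  The Fock space is axiomatised as a nonzero module over the Clifford algebra of the modes
  \<open>b i\<close>, \<open>c i\<close> that is generated by a vacuum vector satisfying the annihilation conditions.
  \<open>cyclic\<close> says that the only invariant subspace containing the vacuum is the whole space.
  These conditions determine the Fock space up to isomorphism; a model is constructed at the
  end of this theory (\<open>fock_space_model\<close>).
\<close>

locale fock_space = vector_space scale
  for scale :: "'k::field_char_0 \<Rightarrow> 'v::ab_group_add \<Rightarrow> 'v"  (infixr \<open>*s\<close> 75)
    and b c :: "int \<Rightarrow> 'v \<Rightarrow> 'v"
    and vac :: 'v +
  assumes linear_b: "Vector_Spaces.linear scale scale (b i)"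
    and linear_c: "Vector_Spaces.linear scale scale (c i)"
    and anticomm_bc: "b i (c j v) + c j (b i v) = (if i = - j then v else 0)"
    and anticomm_bb: "b i (b j v) + b j (b i v) = 0"
    and anticomm_cc: "c i (c j v) + c j (c i v) = 0"
    and b_vac: "m \<ge> 0 \<Longrightarrow> b (m + 1) vac = 0"
    and c_vac: "m \<ge> 0 \<Longrightarrow> c m vac = 0"
    and vac_nonzero: "vac \<noteq> 0"
    and cyclic: "\<lbrakk>subspace W; vac \<in> W; \<And>i w. w \<in> W \<Longrightarrow> b i w \<in> W; \<And>i w. w \<in> W \<Longrightarrow> c i w \<in> W\<rbrakk>
                 \<Longrightarrow> W = UNIV"

section \<open>The operator \<open>B(x)\<close>\<close>

text \<open>
  Exponential of a locally nilpotent operator: \<open>Sum_any\<close> is the sum of a family with finitely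
  many nonzero terms.
\<close>

definition exp_op :: "('k::field_char_0 \<Rightarrow> 'v::ab_group_add \<Rightarrow> 'v) \<Rightarrow> ('v \<Rightarrow> 'v) \<Rightarrow> 'v \<Rightarrow> 'v" where
  "exp_op scale A v = Sum_any (\<lambda>k::nat. scale (inverse (fact k)) ((A ^^ k) v))"

definition B_factor :: "('k::field_char_0 \<Rightarrow> 'v::ab_group_add \<Rightarrow> 'v)
    \<Rightarrow> (int \<Rightarrow> 'v \<Rightarrow> 'v) \<Rightarrow> (int \<Rightarrow> 'v \<Rightarrow> 'v) \<Rightarrow> 'k \<Rightarrow> int \<Rightarrow> 'v \<Rightarrow> 'v" where
  "B_factor scale b c x i = exp_op scale (\<lambda>v. scale x (b (- (i - 1)) (c (i - 2) v)))"

text \<open>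
  The product of the \<open>n\<close> leftmost factors, \<open>i = M, M - 1, \<dots>, M - n + 1\<close> from left to right,
  so that the factor with the smallest \<open>i\<close> is applied first.
\<close>

definition B_partial :: "('k::field_char_0 \<Rightarrow> 'v::ab_group_add \<Rightarrow> 'v)
    \<Rightarrow> (int \<Rightarrow> 'v \<Rightarrow> 'v) \<Rightarrow> (int \<Rightarrow> 'v \<Rightarrow> 'v) \<Rightarrow> nat \<Rightarrow> 'k \<Rightarrow> nat \<Rightarrow> 'v \<Rightarrow> 'v" where
  "B_partial scale b c M x n v = foldr (\<lambda>j. B_factor scale b c x (int M - int j)) [0..<n] v"

text \<open>
  The infinite product, evaluated at \<open>v\<close>, is the value at which the partial products become
  stationary.
\<close>

definition B_op :: "('k::field_char_0 \<Rightarrow> 'v::ab_group_add \<Rightarrow> 'v)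
    \<Rightarrow> (int \<Rightarrow> 'v \<Rightarrow> 'v) \<Rightarrow> (int \<Rightarrow> 'v \<Rightarrow> 'v) \<Rightarrow> nat \<Rightarrow> 'k \<Rightarrow> 'v \<Rightarrow> 'v" where
  "B_op scale b c M x v =
     (THE w. eventually (\<lambda>n. B_partial scale b c M x n v = w) sequentially)"

section \<open>Partitions\<close>

text \<open>
  A partition is a weakly decreasing list of naturals; zero parts are allowed and the length of
  the list matters.  The part \<open>\<mu>\<^sub>i\<close> (\<open>i \<ge> 1\<close>) is \<open>\<mu> ! (i - 1)\<close>, and \<open>|\<mu>|\<close> is \<open>sum_list \<mu>\<close>.
\<close>

definition is_partition :: "nat list \<Rightarrow> bool" where
  "is_partition \<mu> \<longleftrightarrow> sorted_wrt (\<ge>) \<mu>"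

definition interlaces :: "nat list \<Rightarrow> nat list \<Rightarrow> bool" where
  "interlaces \<mu> \<nu> \<longleftrightarrow> length \<mu> = length \<nu> + 1 \<and>
     (\<forall>i < length \<nu>. \<mu> ! i \<ge> \<nu> ! i \<and> \<nu> ! i \<ge> \<mu> ! (i + 1))"

definition ket :: "(int \<Rightarrow> 'v \<Rightarrow> 'v) \<Rightarrow> (int \<Rightarrow> 'v \<Rightarrow> 'v) \<Rightarrow> 'v \<Rightarrow> nat list \<Rightarrow> 'v" where
  "ket b c vac \<mu> =
     foldr (\<lambda>i. b (- (int (\<mu> ! (i - 1)) - int i))) [1..<length \<mu> + 1]
       (foldr (\<lambda>i. c (- int i)) (rev [1..<length \<mu> + 1]) vac)"

section \<open>A model of the axioms\<close>

text \<open>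
  Basis vectors are finite sets \<open>S\<close> of integers: \<open>n \<in> S\<close> means that \<open>b n\<close> (if \<open>n \<le> 0\<close>)
  respectively \<open>c (-n)\<close> (if \<open>n > 0\<close>) has been applied to the vacuum.  The operators are
  Jordan-Wigner operators.
\<close>

definition jw_toggle :: "int \<Rightarrow> int fset \<Rightarrow> int fset" where
  "jw_toggle n S = (if n |\<in>| S then S |-| {|n|} else finsert n S)"

definition jw_sign :: "int \<Rightarrow> int fset \<Rightarrow> 'k::field_char_0" where
  "jw_sign n S = (- 1) ^ card {k \<in> fset S. k < n}"

lemma jw_toggle_mem: "m |\<in>| jw_toggle n S \<longleftrightarrow> (if m = n then n |\<notin>| S else m |\<in>| S)"
  by (auto simp: jw_toggle_def)

lemma jw_toggle_toggle [simp]: "jw_toggle n (jw_toggle n S) = S"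
  by (rule fset_eqI) (simp add: jw_toggle_mem)

lemma jw_toggle_commute: "jw_toggle n (jw_toggle m S) = jw_toggle m (jw_toggle n S)"
  by (rule fset_eqI) (simp add: jw_toggle_mem)

lemma jw_sign_sq [simp]: "jw_sign n S * jw_sign n S = (1 :: 'k::field_char_0)"
  by (simp add: jw_sign_def flip: power_add)

lemma jw_sign_sq' [simp]: "jw_sign n S * (jw_sign n S * y) = (y :: 'k::field_char_0)"
  by (simp flip: mult.assoc)

lemma jw_finite: "finite {k \<in> fset S. P k}"
  by (rule finite_subset[OF _ finite_fset[of S]]) auto

lemma jw_sign_toggle:
  "jw_sign m (jw_toggle n S) = (if n < m then - jw_sign m S else (jw_sign m S :: 'k::field_char_0))"
proof (cases "n < m")
  case True
  show ?thesis
  proof (cases "n |\<in>| S")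
    case True
    then have "{k \<in> fset S. k < m} = insert n {k \<in> fset (jw_toggle n S). k < m}"
      using \<open>n < m\<close> by (auto simp: jw_toggle_mem)
    moreover have "n \<notin> {k \<in> fset (jw_toggle n S). k < m}"
      using True by (simp add: jw_toggle_mem)
    ultimately have "card {k \<in> fset S. k < m} = Suc (card {k \<in> fset (jw_toggle n S). k < m})"
      by (metis card_insert_disjoint jw_finite)
    then show ?thesis using \<open>n < m\<close> by (simp add: jw_sign_def)
  next
    case False
    then have "{k \<in> fset (jw_toggle n S). k < m} = insert n {k \<in> fset S. k < m}"
      using \<open>n < m\<close> by (auto simp: jw_toggle_mem)
    then have "card {k \<in> fset (jw_toggle n S). k < m} = Suc (card {k \<in> fset S. k < m})"
      using False by simp
    then show ?thesis using \<open>n < m\<close> by (simp add: jw_sign_def)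
  qed
next
  case False
  then have "{k \<in> fset (jw_toggle n S). k < m} = {k \<in> fset S. k < m}"
    by (auto simp: jw_toggle_mem)
  then show ?thesis using False by (simp add: jw_sign_def)
qed

lift_definition jw_op :: "int \<Rightarrow> bool \<Rightarrow> (int fset \<Rightarrow>\<^sub>0 'k::field_char_0) \<Rightarrow> (int fset \<Rightarrow>\<^sub>0 'k)"
  is "\<lambda>n d v S. if (n |\<in>| S) = d then jw_sign n S * v (jw_toggle n S) else 0"
proof -
  fix n d and v :: "int fset \<Rightarrow> 'k"
  assume "finite {S. v S \<noteq> 0}"
  then have "finite (jw_toggle n ` {S. v S \<noteq> 0})" by simp
  moreover have "{S. (if (n |\<in>| S) = d then jw_sign n S * v (jw_toggle n S) else 0) \<noteq> 0}
      \<subseteq> jw_toggle n ` {S. v S \<noteq> 0}"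
    by (auto intro!: image_eqI[where x = "jw_toggle n S" for S])
  ultimately show "finite {S. (if (n |\<in>| S) = d then jw_sign n S * v (jw_toggle n S) else 0) \<noteq> 0}"
    by (rule rev_finite_subset)
qed

definition jw_scale :: "'k \<Rightarrow> (int fset \<Rightarrow>\<^sub>0 'k::field_char_0) \<Rightarrow> (int fset \<Rightarrow>\<^sub>0 'k)" where
  "jw_scale a = Poly_Mapping.map ((*) a)"

lemma lookup_jw_scale [simp]: "Poly_Mapping.lookup (jw_scale a v) S = a * Poly_Mapping.lookup v S"
  unfolding jw_scale_def by transfer (simp add: when_def)

lemma jw_op_anticomm:
  "jw_op n d (jw_op m e v) + jw_op m e (jw_op n d v) = (if n = m \<and> d \<noteq> e then v else 0)"
proof (rule poly_mapping_eqI)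
  fix S :: "int fset"
  show "Poly_Mapping.lookup (jw_op n d (jw_op m e v) + jw_op m e (jw_op n d v)) S
      = Poly_Mapping.lookup (if n = m \<and> d \<noteq> e then v else 0) S"
  proof (cases "n = m")
    case True
    then show ?thesis
      by (auto simp: lookup_add jw_op.rep_eq jw_sign_toggle jw_toggle_mem)
  next
    case False
    then show ?thesis
      by (auto simp: lookup_add jw_op.rep_eq jw_sign_toggle jw_toggle_mem jw_toggle_commute[of n m])
  qed
qed

theorem fock_space_model:
  "fock_space (jw_scale :: 'k::field_char_0 \<Rightarrow> _)
     (\<lambda>i. jw_op i (i \<le> 0)) (\<lambda>i. jw_op (- i) (\<not> - i \<le> 0)) (Poly_Mapping.single {||} 1)"
proof -
  interpret vector_space "jw_scale :: 'k \<Rightarrow> _"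
    by unfold_locales (auto intro!: poly_mapping_eqI simp: lookup_add algebra_simps)
  have add: "jw_op n d (v + w) = jw_op n d v + jw_op n d w"
    for n d and v w :: "int fset \<Rightarrow>\<^sub>0 'k"
    by (rule poly_mapping_eqI) (simp add: lookup_add jw_op.rep_eq algebra_simps)
  have scale: "jw_op n d (jw_scale a v) = jw_scale a (jw_op n d v)"
    for n d a and v :: "int fset \<Rightarrow>\<^sub>0 'k"
    by (rule poly_mapping_eqI) (simp add: jw_op.rep_eq algebra_simps)
  have vac: "jw_op n False (Poly_Mapping.single {||} (1::'k)) = 0" for n
    by (rule poly_mapping_eqI) (auto simp: jw_op.rep_eq lookup_single when_def jw_toggle_def)
  have cyc: "W = UNIV"
    if W: "subspace W" "Poly_Mapping.single {||} 1 \<in> W"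
      and Wb: "\<And>i w. w \<in> W \<Longrightarrow> jw_op i (i \<le> 0) w \<in> W"
      and Wc: "\<And>i w. w \<in> W \<Longrightarrow> jw_op (- i) (\<not> - i \<le> 0) w \<in> W"
    for W :: "(int fset \<Rightarrow>\<^sub>0 'k) set"
  proof -
    have Wop: "jw_op n True w \<in> W" if "w \<in> W" for n w
      using Wb[OF that, of n] Wc[OF that, of "- n"] by (cases "n \<le> 0") auto
    have basis: "Poly_Mapping.single S 1 \<in> W" for S
    proof (induction S)
      case empty
      show ?case by (rule W)
    next
      case (insert n S)
      have flip: "S = jw_toggle n T \<longleftrightarrow> finsert n S = T" for T
      proof -
        have "S = jw_toggle n T \<longleftrightarrow> jw_toggle n S = T"
          by (metis jw_toggle_toggle)
        then show ?thesis using insert.hyps by (simp add: jw_toggle_def)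
      qed
      have "Poly_Mapping.single (finsert n S) (1::'k)
          = jw_scale (jw_sign n (finsert n S)) (jw_op n True (Poly_Mapping.single S 1))"
        by (rule poly_mapping_eqI) (auto simp: lookup_single when_def jw_op.rep_eq flip)
      then show ?case
        by (simp only: subspace_scale[OF W(1) Wop[OF insert.IH]])
    qed
    have "v \<in> W" for v
    proof -
      have "v = (\<Sum>S\<in>Poly_Mapping.keys v. jw_scale (Poly_Mapping.lookup v S) (Poly_Mapping.single S 1))"
        by (rule poly_mapping_eqI)
           (auto simp: lookup_sum lookup_single when_def in_keys_iff if_distrib sum.delta cong: if_cong)
      also have "\<dots> \<in> W"
        using W(1) basis by (intro subspace_sum subspace_scale)
      finally show ?thesis .
    qed
    then show ?thesis by auto
  qed
  have nz: "Poly_Mapping.single {||} (1::'k) \<noteq> 0"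
    by (metis lookup_single_eq lookup_zero zero_neq_one)
  show ?thesis
    by (unfold_locales; (rule cyc; assumption)?) (auto simp: add scale jw_op_anticomm vac nz)
qed

end

theory Submission
  imports Defs
begin

text \<open>
  Read \<open>b (- p)\<close> as putting a particle at position \<open>p\<close> and \<open>c p\<close> as taking one away.  In the
  vacuum exactly the negative positions are filled, and the vector of \<open>\<nu>\<close> has particles at
  \<open>\<nu>\<^sub>i - i\<close> for \<open>i \<le> l\<close> above a sea filling all positions below \<open>-l\<close>.  The factor with index
  \<open>i\<close> of \<open>B(x)\<close> lets a particle at \<open>i - 2\<close> hop to \<open>i - 1\<close> at the cost of a factor \<open>x\<close>; the
  factors act from low to high positions, so one particle can be carried upwards by several
  factors in a row, but never beyond \<open>M - 1\<close>.

  Adding a zero part to \<open>\<nu>\<close> does not change the vector (\<open>ket_append_zero\<close>); it only shows the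
  topmost particle of the sea explicitly.  In this form the factors whose target lies at or below
  \<open>-l - 1\<close> do nothing since their target is filled (\<open>B_factor_ket_trivial\<close>), while the finitely
  many remaining ones fix the lowered sea since their source is empty in it (\<open>B_partial_sea\<close>).
  Moving these past the creation operators turns each \<open>b (- p)\<close> into
  \<open>\<Sum>r = p..M - 1. x\<^bsup>r - p\<^esup> b (- r)\<close> (\<open>B_partial_b\<close>), so the particles seem to hop independently.

  The exclusion principle makes the hops depend on each other: this sum squares to zero, and for
  \<open>p \<le> s\<close> the part of the sum for \<open>p\<close> with \<open>r \<ge> s\<close> is a multiple of the sum for \<open>s\<close>.  Hence,
  next to the particle starting at \<open>s\<close>, the particle starting at \<open>p\<close> may be confined to
  positions below \<open>s\<close> (\<open>hop_truncate\<close>).  That the \<open>i\<close>-th particle stays below the initial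
  position of the next higher one says precisely \<open>\<nu>\<^sub>i \<le> \<mu>\<^sub>i \<le> \<nu>\<^sub>i\<^sub>-\<^sub>1\<close> (with \<open>M\<close> in
  place of \<open>\<nu>\<^sub>0\<close>), which is interlacing.
\<close>

section \<open>The Clifford relations\<close>

context fock_space
begin

lemma b_add: "b i (v + w) = b i v + b i w"
  and b_scale: "b i (a *s v) = a *s b i v"
  and b_zero [simp]: "b i 0 = 0"
  and b_minus: "b i (- v) = - b i v"
  and b_diff: "b i (v - w) = b i v - b i w"
  and b_sum: "b i (sum f A) = (\<Sum>t\<in>A. b i (f t))"
proof -
  interpret L: Vector_Spaces.linear scale scale "b i" by (rule linear_b)
  show "b i (v + w) = b i v + b i w" "b i (a *s v) = a *s b i v" "b i 0 = 0" "b i (- v) = - b i v"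
    "b i (v - w) = b i v - b i w" "b i (sum f A) = (\<Sum>t\<in>A. b i (f t))"
    by (rule L.add L.scale L.zero L.neg L.diff L.sum)+
qed

lemma c_add: "c i (v + w) = c i v + c i w"
  and c_scale: "c i (a *s v) = a *s c i v"
  and c_zero [simp]: "c i 0 = 0"
proof -
  interpret L: Vector_Spaces.linear scale scale "c i" by (rule linear_c)
  show "c i (v + w) = c i v + c i w" "c i (a *s v) = a *s c i v" "c i 0 = 0"
    by (rule L.add L.scale L.zero)+
qed

lemma eq_zero_if_add_self_eq_zero:
  fixes v :: 'v
  assumes "v + v = 0"
  shows "v = 0"
proof -
  have "((1::'k) + 1) *s v = 0"
    using assms by (simp only: scale_left_distrib scale_one)
  then show ?thesis by simp
qed

lemma b_swap: "b i (b j v) = - b j (b i v)"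
  using anticomm_bb[of i j v] by (simp add: eq_neg_iff_add_eq_0)

lemma c_swap: "c i (c j v) = - c j (c i v)"
  using anticomm_cc[of i j v] by (simp add: eq_neg_iff_add_eq_0)

lemma b_b_eq_zero [simp]: "b i (b i v) = 0"
  by (rule eq_zero_if_add_self_eq_zero) (rule anticomm_bb)

lemma c_c_eq_zero [simp]: "c i (c i v) = 0"
  by (rule eq_zero_if_add_self_eq_zero) (rule anticomm_cc)

lemma c_b_swap: "c j (b i v) = (if i = - j then v else 0) - b i (c j v)"
  using anticomm_bc[of i j v] by (simp add: eq_diff_eq add.commute)

end

section \<open>Factors and partial products of \<open>B(x)\<close>\<close>

context fock_space
begin

text \<open>
  The exponential stops after the linear term: the exponent contains \<open>b (- (i - 1))\<close>, which
  anticommutes with \<open>c (i - 2)\<close> and squares to zero, so the exponent squares to zero.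
\<close>

lemma B_factor_eq: "B_factor scale b c x i v = v + x *s b (- (i - 1)) (c (i - 2) v)"
proof -
  define A where "A = (\<lambda>v. x *s b (- (i - 1)) (c (i - 2) v))"
  have A_A: "A (A v) = 0" for v
    by (simp add: A_def b_scale c_scale c_b_swap b_minus)
  have A_zero: "A 0 = 0" by (simp add: A_def)
  have *: "(A ^^ k) v = 0" if "k \<ge> 2" for k
    using that by (induction k rule: dec_induct) (simp_all add: eval_nat_numeral A_A A_zero)
  have "B_factor scale b c x i v = Sum_any (\<lambda>k::nat. inverse (fact k) *s (A ^^ k) v)"
    by (simp add: B_factor_def exp_op_def A_def)
  also have "\<dots> = (\<Sum>k\<in>{..<2}. inverse (fact k) *s (A ^^ k) v)"
  proof (rule Sum_any.expand_superset)
    show "{k. inverse (fact k) *s (A ^^ k) v \<noteq> 0} \<subseteq> {..<2}"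
      using * by (auto simp: not_less[symmetric])
  qed simp
  also have "\<dots> = v + A v" by (simp add: eval_nat_numeral)
  finally show ?thesis by (simp add: A_def)
qed

text \<open>
  A hop sees only the particle at its source \<open>i - 2\<close>.  The correction term may be written with
  the factor applied to \<open>w\<close> rather than \<open>w\<close> itself, since \<open>b (- (i - 1))\<close> annihilates the
  difference.
\<close>

lemma B_factor_b:
  "B_factor scale b c x i (b (- p) w) = b (- p) (B_factor scale b c x i w)
     + (if p = i - 2 then x *s b (- (i - 1)) (B_factor scale b c x i w) else 0)"
proof -
  have "b (1 - i) (b (- p) v) = - b (- p) (b (1 - i) v)" for v
    by (rule b_swap)
  then show ?thesis
    by (auto simp: B_factor_eq b_add b_diff b_scale c_b_swap b_minus algebra_simps)
qed

lemma B_partial_0 [simp]: "B_partial scale b c M x 0 v = v"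
  by (simp add: B_partial_def)

lemma B_partial_Suc [simp]:
  "B_partial scale b c M x (Suc n) v
     = B_partial scale b c M x n (B_factor scale b c x (int M - int n) v)"
  by (simp add: B_partial_def)

lemma B_partial_add:
  "B_partial scale b c M x n (v + w) = B_partial scale b c M x n v + B_partial scale b c M x n w"
  by (induction n arbitrary: v w)
     (simp_all add: B_factor_eq b_add c_add scale_right_distrib add_ac)

lemma B_partial_scale: "B_partial scale b c M x n (a *s v) = a *s B_partial scale b c M x n v"
proof (induction n arbitrary: v)
  case (Suc n)
  have "B_factor scale b c x i (a *s v) = a *s B_factor scale b c x i v" for i
    by (simp add: B_factor_eq b_scale c_scale scale_right_distrib mult.commute)
  then show ?case by (simp add: Suc)
qed simp

lemma B_partial_b_commute:
  assumes "p < int M - int n - 1"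
  shows "B_partial scale b c M x n (b (- p) w) = b (- p) (B_partial scale b c M x n w)"
  using assms by (induction n arbitrary: w) (auto simp: B_factor_b)

end

section \<open>Sums over the possible destinations of a particle\<close>

context fock_space
begin

text \<open>
  A particle starts at \<open>p\<close> and is created anywhere in \<open>{p..q}\<close>, weighted by the distance
  travelled.  Integer positions, rather than parts, keep the ranges free of the shift by \<open>i\<close>.
\<close>

definition hop :: "'k \<Rightarrow> int \<Rightarrow> int \<Rightarrow> 'v \<Rightarrow> 'v" where
  "hop x p q w = (\<Sum>r\<in>{p..q}. x ^ nat (r - p) *s b (- r) w)"

lemma hop_split:
  assumes "p \<le> s" "s \<le> q + 1"
  shows "hop x p q w = hop x p (s - 1) w + x ^ nat (s - p) *s hop x s q w"
proof -
  have "{p..q} = {p..s - 1} \<union> {s..q}" using assms by auto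
  then have "hop x p q w = hop x p (s - 1) w + (\<Sum>r\<in>{s..q}. x ^ nat (r - p) *s b (- r) w)"
    by (simp add: hop_def sum.union_disjoint)
  also have "(\<Sum>r\<in>{s..q}. x ^ nat (r - p) *s b (- r) w) = x ^ nat (s - p) *s hop x s q w"
    using assms unfolding hop_def scale_sum_right
    by (intro sum.cong) (auto simp: nat_diff_distrib simp flip: power_add nat_add_distrib)
  finally show ?thesis .
qed

lemma hop_singleton [simp]: "hop x p p w = b (- p) w"
  by (simp add: hop_def)

lemma hop_add: "hop x p q (v + w) = hop x p q v + hop x p q w"
  by (simp add: hop_def b_add scale_right_distrib sum.distrib)

lemma hop_scale: "hop x p q (a *s w) = a *s hop x p q w"
  by (simp add: hop_def b_scale scale_sum_right mult.commute)

text \<open>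
  A linear combination of pairwise anticommuting operators that square to zero again squares to
  zero: the double sum changes sign when its two indices are exchanged.
\<close>

lemma hop_hop_eq_zero [simp]: "hop x p q (hop x p q w) = 0"
proof (rule eq_zero_if_add_self_eq_zero)
  let ?f = "\<lambda>r s. (x ^ nat (r - p) * x ^ nat (s - p)) *s b (- r) (b (- s) w)"
  have eq: "hop x p q (hop x p q w) = (\<Sum>r\<in>{p..q}. \<Sum>s\<in>{p..q}. ?f r s)"
    by (simp add: hop_def b_sum b_scale scale_sum_right)
  have "hop x p q (hop x p q w) + hop x p q (hop x p q w)
      = (\<Sum>r\<in>{p..q}. \<Sum>s\<in>{p..q}. ?f r s) + (\<Sum>r\<in>{p..q}. \<Sum>s\<in>{p..q}. ?f s r)"
    unfolding eq by (subst (2) sum.swap) simp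
  also have "\<dots> = (\<Sum>r\<in>{p..q}. \<Sum>s\<in>{p..q}. ?f r s + ?f s r)"
    by (simp add: sum.distrib)
  also have "\<dots> = 0"
    by (intro sum.neutral ballI)
       (simp add: mult.commute anticomm_bb flip: scale_right_distrib)
  finally show "hop x p q (hop x p q w) + hop x p q (hop x p q w) = 0" .
qed

text \<open>
  The exclusion principle.  The contributions with destination at least \<open>s\<close> form a multiple of
  \<open>hop x s q w\<close>, which a second application of \<open>hop x s q\<close> kills.  For \<open>s = q + 1\<close> both
  sides vanish.
\<close>

lemma hop_truncate:
  assumes "p \<le> s" "s \<le> q + 1"
  shows "hop x s q (hop x p q w) = hop x s q (hop x p (s - 1) w)"
  by (simp add: hop_split[OF assms] hop_add hop_scale)

text \<open>
  The \<open>n\<close> leftmost factors have sources from \<open>M - n - 1\<close> to \<open>M - 2\<close>.  A particle starting at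
  the lowest source either stays there for good, because the later factors only have higher
  sources, or moves up one step and is then in the situation of the induction hypothesis.
\<close>

lemma B_partial_b:
  assumes "int M - int n - 1 \<le> p" "p \<le> int M - 1"
  shows "B_partial scale b c M x n (b (- p) w) = hop x p (int M - 1) (B_partial scale b c M x n w)"
  using assms
proof (induction n arbitrary: p w)
  case 0
  then have "p = int M - 1" by simp
  then show ?case by simp
next
  case (Suc n)
  define v where "v = B_factor scale b c x (int M - int n) w"
  show ?case
  proof (cases "p = int M - int n - 2")
    case True
    have "B_factor scale b c x (int M - int n) (b (- p) w) = b (- p) v + x *s b (- (p + 1)) v"
      using True by (subst B_factor_b) (simp add: v_def)
    then have "B_partial scale b c M x (Suc n) (b (- p) w)
        = B_partial scale b c M x n (b (- p) v) + x *s B_partial scale b c M x n (b (- (p + 1)) v)"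
      by (simp add: B_partial_add B_partial_scale)
    also have "\<dots> = b (- p) (B_partial scale b c M x n v)
        + x *s hop x (p + 1) (int M - 1) (B_partial scale b c M x n v)"
      using True Suc.IH[of "p + 1" v] Suc.prems B_partial_b_commute[of p M n x v] by simp
    also have "\<dots> = hop x p (int M - 1) (B_partial scale b c M x n v)"
      using True Suc.prems by (subst hop_split[of p "p + 1"]) auto
    finally show ?thesis by (simp add: v_def)
  next
    case False
    then show ?thesis using Suc by (simp add: B_factor_b)
  qed
qed

end

section \<open>Kets as particles above a sea\<close>

context fock_space
begin

text \<open>
  The list holds the parts number \<open>k\<close>, \<open>k + 1\<close>, \<open>\<dots>\<close> of a partition; the explicit start index
  makes the definition accessible to induction on the list.
\<close>

primrec create :: "int \<Rightarrow> nat list \<Rightarrow> 'v \<Rightarrow> 'v" where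
  "create k [] w = w"
| "create k (m # ms) w = b (- (int m - k)) (create (k + 1) ms w)"

text \<open>The vacuum with its \<open>l\<close> highest particles removed.\<close>

primrec sea :: "nat \<Rightarrow> 'v" where
  "sea 0 = vac"
| "sea (Suc l) = c (- int (Suc l)) (sea l)"

lemma ket_eq_create: "ket b c vac \<mu> = create 1 \<mu> (sea (length \<mu>))"
proof -
  have create: "foldr (\<lambda>i. b (- (int (\<mu> ! (i - k)) - int i))) [k..<length \<mu> + k] w
      = create (int k) \<mu> w" for k w
  proof (induction \<mu> arbitrary: k)
    case (Cons m ms)
    have "foldr (\<lambda>i. b (- (int ((m # ms) ! (i - k)) - int i))) [Suc k..<length ms + Suc k] w
        = foldr (\<lambda>i. b (- (int (ms ! (i - Suc k)) - int i))) [Suc k..<length ms + Suc k] w"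
      by (rule foldr_cong) (auto simp: nth_Cons')
    then show ?case
      using Cons[of "Suc k"] by (simp add: upt_conv_Cons add.commute del: upt_Suc)
  qed simp
  moreover have "foldr (\<lambda>i. c (- int i)) (rev [1..<l + 1]) vac = sea l" for l
    by (induction l) auto
  ultimately show ?thesis
    using create[of 1] by (simp add: ket_def del: upt_Suc)
qed

lemma b_sea: "int l < k \<Longrightarrow> b k (sea l) = 0"
proof (induction l)
  case 0
  then show ?case using b_vac[of "k - 1"] by simp
next
  case (Suc l)
  then show ?case
    using anticomm_bc[of k "- int (Suc l)" "sea l"] by simp
qed

lemma c_sea: "- int l \<le> k \<Longrightarrow> c k (sea l) = 0"
proof (induction l)
  case 0
  then show ?case by (simp add: c_vac)
next
  case (Suc l)
  then show ?case
    using c_swap[of k "- int (Suc l)" "sea l"] by (cases "k = - int (Suc l)") auto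
qed

lemma create_snoc: "create k (ms @ [m]) w = create k ms (b (- (int m - k - int (length ms))) w)"
  by (induction ms arbitrary: k) (auto simp: algebra_simps)

text \<open>
  A zero part in place \<open>l + 1\<close> refills the position \<open>-(l + 1)\<close> that lowering the sea has emptied:
  \<open>b (l + 1)\<close> and \<open>c (- (l + 1))\<close> cancel on a vector annihilated by \<open>b (l + 1)\<close>.
\<close>

lemma ket_append_zero: "ket b c vac (\<nu> @ [0]) = ket b c vac \<nu>"
  using anticomm_bc[of "int (Suc (length \<nu>))" "- int (Suc (length \<nu>))" "sea (length \<nu>)"]
  by (simp add: ket_eq_create create_snoc b_sea add.commute)

lemma b_create_eq_zero: "b j w = 0 \<Longrightarrow> b j (create k ms w) = 0"
  by (induction ms arbitrary: k) (auto simp: b_swap[of j])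

text \<open>The target \<open>i - 1\<close> of the hop is already occupied by the sea.\<close>

lemma B_factor_ket_trivial:
  assumes "i \<le> - int (length \<nu>)"
  shows "B_factor scale b c x i (ket b c vac \<nu>) = ket b c vac \<nu>"
proof -
  have "b (- (i - 1)) (ket b c vac \<nu>) = 0"
    unfolding ket_eq_create using assms by (intro b_create_eq_zero b_sea) auto
  then show ?thesis
    using anticomm_bc[of "- (i - 1)" "i - 2" "ket b c vac \<nu>"] by (simp add: B_factor_eq)
qed

text \<open>Every source of these factors is a position that is empty in \<open>sea l\<close>.\<close>

lemma B_partial_sea:
  assumes "int n \<le> int M + int l - 1"
  shows "B_partial scale b c M x n (sea l) = sea l"
  using assms by (induction n) (auto simp: B_factor_eq c_sea)

lemma B_op_ket:
  "B_op scale b c M x (ket b c vac \<nu>)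
     = B_partial scale b c M x (M + length \<nu>) (ket b c vac \<nu>)"
proof -
  define N where "N = M + length \<nu>"
  define w where "w = B_partial scale b c M x N (ket b c vac \<nu>)"
  have "B_partial scale b c M x n (ket b c vac \<nu>) = w" if "N \<le> n" for n
    using that
  proof (induction n rule: dec_induct)
    case base
    show ?case by (simp add: w_def)
  next
    case (step n)
    then show ?case by (simp add: B_factor_ket_trivial N_def)
  qed
  then have ev: "eventually (\<lambda>n. B_partial scale b c M x n (ket b c vac \<nu>) = w) sequentially"
    by (auto simp: eventually_sequentially)
  moreover have "w' = w"
    if "eventually (\<lambda>n. B_partial scale b c M x n (ket b c vac \<nu>) = w') sequentially" for w'
  proof -
    have "eventually (\<lambda>n. w' = w) sequentially"
      using ev that by eventually_elim simp
    then show ?thesis by simp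
  qed
  ultimately have "B_op scale b c M x (ket b c vac \<nu>) = w"
    unfolding B_op_def by (rule the_equality)
  then show ?thesis by (simp add: w_def N_def)
qed

end

section \<open>From independent to interlacing hops\<close>

context fock_space
begin

text \<open>
  In \<open>free_hops\<close> every particle may travel as far as \<open>q\<close>; in \<open>blocked_hops\<close> this holds only for
  the first one, and each other particle has to stay below the starting point \<open>n - k\<close> of its
  predecessor.
\<close>

primrec free_hops :: "'k \<Rightarrow> int \<Rightarrow> int \<Rightarrow> nat list \<Rightarrow> 'v \<Rightarrow> 'v" where
  "free_hops x q k [] w = w"
| "free_hops x q k (n # ns) w = hop x (int n - k) q (free_hops x q (k + 1) ns w)"

primrec blocked_hops :: "'k \<Rightarrow> int \<Rightarrow> int \<Rightarrow> nat list \<Rightarrow> 'v \<Rightarrow> 'v" where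
  "blocked_hops x q k [] w = w"
| "blocked_hops x q k (n # ns) w = hop x (int n - k) q (blocked_hops x (int n - k - 1) (k + 1) ns w)"

lemma B_partial_create:
  assumes "\<And>m. m \<in> set ms \<Longrightarrow> m \<le> M" "1 \<le> k" "k + int (length ms) \<le> int n + 2 - int M"
  shows "B_partial scale b c M x n (create k ms w)
       = free_hops x (int M - 1) k ms (B_partial scale b c M x n w)"
  using assms
proof (induction ms arbitrary: k)
  case (Cons m ms)
  have "m \<le> M" using Cons.prems by simp
  then have "B_partial scale b c M x n (create k (m # ms) w)
      = hop x (int m - k) (int M - 1) (B_partial scale b c M x n (create (k + 1) ms w))"
    using Cons.prems(2,3) by (simp only: create.simps list.size) (rule B_partial_b; linarith)
  then show ?case using Cons by simp
qed simp

text \<open>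
  By induction from the innermost particle outwards.  Once the tail is in blocked form, its first
  particle is the only one that can still reach up to \<open>q\<close>, and \<open>hop_truncate\<close> confines it next to
  the particle now added.
\<close>

lemma free_hops_eq_blocked_hops:
  assumes "is_partition ns" "ns \<noteq> [] \<Longrightarrow> int (hd ns) - k \<le> q"
  shows "free_hops x q k ns w = blocked_hops x q k ns w"
  using assms
proof (induction ns arbitrary: k)
  case (Cons n ns)
  have IH: "free_hops x q (k + 1) ns w = blocked_hops x q (k + 1) ns w"
    using Cons.prems by (intro Cons.IH) (auto simp: is_partition_def neq_Nil_conv)
  show ?case
  proof (cases ns)
    case Nil
    then show ?thesis by simp
  next
    case (Cons n' ns')
    then show ?thesis
      using IH Cons.prems by (simp add: hop_truncate is_partition_def)
  qed
qed simp

end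

text \<open>
  The outcomes of \<open>blocked_hops\<close> in terms of parts: staying below the position \<open>n - k\<close> of part
  number \<open>k\<close> means for part number \<open>k + 1\<close> to be at most \<open>n\<close>.
\<close>

primrec blocked_parts :: "nat \<Rightarrow> nat list \<Rightarrow> nat list set" where
  "blocked_parts u [] = {[]}"
| "blocked_parts u (n # ns) = (\<lambda>(m, ms). m # ms) ` ({n..u} \<times> blocked_parts n ns)"

lemma sum_list_blocked_parts: "ms \<in> blocked_parts u ns \<Longrightarrow> sum_list ns \<le> sum_list ms"
  by (induction ns arbitrary: u ms) (force intro: add_mono)+

lemma interlaces_Cons:
  "interlaces (m # ms) (n # ns) \<longleftrightarrow> n \<le> m \<and> ms ! 0 \<le> n \<and> interlaces ms ns"
  unfolding interlaces_def by (auto simp: less_Suc_eq_0_disj)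

lemma interlaces_imp_is_partition:
  assumes "interlaces \<mu> \<nu>"
  shows "is_partition \<mu>"
  using assms unfolding is_partition_def interlaces_def
  by (subst sorted_wrt_iff_nth_Suc_transp) (auto intro: transpI order_trans)

text \<open>
  The zero part appended to \<open>\<nu>\<close> imposes no lower bound on the last part of \<open>\<mu>\<close>; it accounts for
  the additional part that \<open>\<mu>\<close> has.
\<close>

lemma blocked_parts_eq_interlacing:
  "blocked_parts u (\<nu> @ [0])
     = {\<mu>. is_partition \<mu> \<and> length \<mu> = length \<nu> + 1 \<and> \<mu> ! 0 \<le> u \<and> interlaces \<mu> \<nu>}"
proof -
  have "\<mu> \<in> blocked_parts u (\<nu> @ [0]) \<longleftrightarrow> \<mu> ! 0 \<le> u \<and> interlaces \<mu> \<nu>" for \<mu>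
  proof (induction \<nu> arbitrary: u \<mu>)
    case Nil
    then show ?case by (auto simp: interlaces_def length_Suc_conv)
  next
    case (Cons n ns)
    show ?case
    proof (cases \<mu>)
      case Nil
      then show ?thesis by (auto simp: interlaces_def)
    next
      case (Cons m ms)
      then show ?thesis
        by (auto simp: interlaces_Cons Cons.IH image_iff)
    qed
  qed
  moreover have "length \<mu> = length \<nu> + 1" if "interlaces \<mu> \<nu>" for \<mu>
    using that by (simp add: interlaces_def)
  ultimately show ?thesis
    by (auto dest: interlaces_imp_is_partition)
qed

context fock_space
begin

lemma hop_nat:
  "hop x (int n - k) (int u - k) w = (\<Sum>m\<in>{n..u}. x ^ (m - n) *s b (- (int m - k)) w)"
proof -
  have "nat (r - (int n - k)) = nat (r + k) - n" for r
    by linarith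
  then show ?thesis
    unfolding hop_def
    by (intro sum.reindex_bij_witness[of _ "\<lambda>m. int m - k" "\<lambda>r. nat (r + k)"]) auto
qed

lemma blocked_hops_expand:
  "blocked_hops x (int u - k) k ns w
     = (\<Sum>\<mu>\<in>blocked_parts u ns. x ^ (sum_list \<mu> - sum_list ns) *s create k \<mu> w)"
proof (induction ns arbitrary: u k)
  case (Cons n ns)
  have "blocked_hops x (int u - k) k (n # ns) w
      = (\<Sum>m\<in>{n..u}. x ^ (m - n) *s b (- (int m - k))
           (\<Sum>\<mu>\<in>blocked_parts n ns. x ^ (sum_list \<mu> - sum_list ns) *s create (k + 1) \<mu> w))"
    using Cons[of n "k + 1"] by (simp add: hop_nat algebra_simps)
  also have "\<dots> = (\<Sum>(m, \<mu>)\<in>{n..u} \<times> blocked_parts n ns.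
      x ^ (m - n + (sum_list \<mu> - sum_list ns)) *s create k (m # \<mu>) w)"
    by (simp add: b_sum b_scale scale_sum_right power_add sum.cartesian_product)
  also have "\<dots> = (\<Sum>(m, \<mu>)\<in>{n..u} \<times> blocked_parts n ns.
      x ^ (sum_list (m # \<mu>) - sum_list (n # ns)) *s create k (m # \<mu>) w)"
    by (intro sum.cong) (auto dest!: sum_list_blocked_parts)
  also have "\<dots> = (\<Sum>\<mu>\<in>blocked_parts u (n # ns).
      x ^ (sum_list \<mu> - sum_list (n # ns)) *s create k \<mu> w)"
    by (simp add: sum.reindex inj_on_def case_prod_unfold)
  finally show ?case .
qed simp

end

theorem theorem2p1:
  fixes scale :: "'k::field_char_0 \<Rightarrow> 'v::ab_group_add \<Rightarrow> 'v"
    and b c :: "int \<Rightarrow> 'v \<Rightarrow> 'v" and vac :: 'v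
    and M :: nat and x :: 'k and \<nu> :: "nat list"
  assumes "fock_space scale b c vac"
    and "M > 0"
    and "is_partition \<nu>"
    and "\<nu> \<noteq> [] \<longrightarrow> \<nu> ! 0 \<le> M"
  shows "B_op scale b c M x (ket b c vac \<nu>) =
    (\<Sum>\<mu> | is_partition \<mu> \<and> length \<mu> = length \<nu> + 1 \<and> \<mu> ! 0 \<le> M \<and> interlaces \<mu> \<nu>.
       scale (x ^ (sum_list \<mu> - sum_list \<nu>)) (ket b c vac \<mu>))"
proof -
  interpret fock_space scale b c vac by fact
  define l where "l = length \<nu>"
  have part: "is_partition (\<nu> @ [0])"
    using assms(3) by (simp add: is_partition_def sorted_wrt_append)
  have le: "m \<le> M" if "m \<in> set (\<nu> @ [0])" for m
    using that assms(3,4) by (cases \<nu>) (auto simp: is_partition_def)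
  have "B_op scale b c M x (ket b c vac \<nu>)
      = B_partial scale b c M x (M + l) (ket b c vac (\<nu> @ [0]))"
    by (simp add: B_op_ket ket_append_zero l_def)
  also have "\<dots> = B_partial scale b c M x (M + l) (create 1 (\<nu> @ [0]) (sea (Suc l)))"
    by (simp add: ket_eq_create l_def del: sea.simps)
  also have "\<dots> = free_hops x (int M - 1) 1 (\<nu> @ [0])
      (B_partial scale b c M x (M + l) (sea (Suc l)))"
    by (rule B_partial_create) (use le in \<open>auto simp: l_def\<close>)
  also have "\<dots> = free_hops x (int M - 1) 1 (\<nu> @ [0]) (sea (Suc l))"
    by (subst B_partial_sea) auto
  also have "\<dots> = blocked_hops x (int M - 1) 1 (\<nu> @ [0]) (sea (Suc l))"
    using part le[of "hd (\<nu> @ [0])"]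
    by (intro free_hops_eq_blocked_hops) (auto simp: hd_append)
  also have "\<dots> = (\<Sum>\<mu>\<in>blocked_parts M (\<nu> @ [0]).
      scale (x ^ (sum_list \<mu> - sum_list \<nu>)) (create 1 \<mu> (sea (Suc l))))"
    by (simp add: blocked_hops_expand)
  also have "\<dots> = (\<Sum>\<mu>\<in>blocked_parts M (\<nu> @ [0]).
      scale (x ^ (sum_list \<mu> - sum_list \<nu>)) (ket b c vac \<mu>))"
    by (intro sum.cong) (auto simp: blocked_parts_eq_interlacing ket_eq_create l_def)
  finally show ?thesis
    by (simp add: blocked_parts_eq_interlacing)
qed

end
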